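(* Let $R$ be a commutative ring with identity such that $2\in R^\times$, and let $C\in\operatorname{Mat}_2(R)$ be cyclic. Then $$D_C=\operatorname{span}_R\{K-K' : K,K'\in\operatorname{Orb}(C)\}=\mathfrak{sl}_2(R).$$
   Context: $\operatorname{Mat}_2(R)$ is the ring of $2\times 2$ matrices over $R$, and $\operatorname{GL}_2(R)$ is its group of units. A matrix $C\in\operatorname{Mat}_2(R)$ is cyclic if there exists $v\in R^2$ such that $(v,Cv)$ is an $R$-basis of $R^2$. The similarity orbit of $C$ is $\operatorname{Orb}(C)=\{PCP^{-1}:P\in\operatorname{GL}_2(R)\}$. The orbit-difference module is $D_C:=\operatorname{span}_R\{K-K':K,K'\in\operatorname{Orb}(C)\}$, and $\mathfrak{sl}_2(R)=\{X\in\operatorname{Mat}_2(R):\operatorname{tr}(X)=0\}$. *)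

theory Defs
  imports "HOL-Analysis.Finite_Cartesian_Product" "HOL-Algebra.Module"
    "Jordan_Normal_Form.Missing_VectorSpace"
begin

text \<open>
  Rings are HOL-Algebra rings with an explicit carrier, so the zero ring is included.
  The types \<open>'a^2\<close> and \<open>'a^2^2\<close> serve only as index-extensional containers; all operations
  come from the ring \<open>R\<close>, not from type classes on \<open>'a\<close>. As in HOL-Analysis, \<open>A $ i $ j\<close> is the
  entry in row \<open>i\<close> and column \<open>j\<close>, and the index type \<open>2\<close> has the two elements \<open>1\<close> and \<open>2\<close>.
\<close>

text \<open>The \<open>R\<close>-module \<open>R\<^sup>2\<close>; the ring fields of the record are irrelevant for a module.\<close>

definition vec2 :: "('a, 'm) ring_scheme \<Rightarrow> ('a, 'a^2) module" where
  "vec2 R = \<lparr>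
     carrier = {v. \<forall>i. v $ i \<in> carrier R},
     mult = undefined,
     one = undefined,
     zero = (\<chi> i. \<zero>\<^bsub>R\<^esub>),
     add = (\<lambda>v w. \<chi> i. v $ i \<oplus>\<^bsub>R\<^esub> w $ i),
     smult = (\<lambda>a v. \<chi> i. a \<otimes>\<^bsub>R\<^esub> v $ i)\<rparr>"

definition mat2 :: "('a, 'm) ring_scheme \<Rightarrow> ('a, 'a^2^2) module" where
  "mat2 R = \<lparr>
     carrier = {A. \<forall>i j. A $ i $ j \<in> carrier R},
     mult = (\<lambda>A B. \<chi> i j. \<Oplus>\<^bsub>R\<^esub>k\<in>UNIV. A $ i $ k \<otimes>\<^bsub>R\<^esub> B $ k $ j),
     one = (\<chi> i j. if i = j then \<one>\<^bsub>R\<^esub> else \<zero>\<^bsub>R\<^esub>),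
     zero = (\<chi> i j. \<zero>\<^bsub>R\<^esub>),
     add = (\<lambda>A B. \<chi> i j. A $ i $ j \<oplus>\<^bsub>R\<^esub> B $ i $ j),
     smult = (\<lambda>a A. \<chi> i j. a \<otimes>\<^bsub>R\<^esub> A $ i $ j)\<rparr>"

definition mat2_mult_vec :: "('a, 'm) ring_scheme \<Rightarrow> 'a^2^2 \<Rightarrow> 'a^2 \<Rightarrow> 'a^2" where
  "mat2_mult_vec R A v = (\<chi> i. \<Oplus>\<^bsub>R\<^esub>j\<in>UNIV. A $ i $ j \<otimes>\<^bsub>R\<^esub> v $ j)"

definition mat2_trace :: "('a, 'm) ring_scheme \<Rightarrow> 'a^2^2 \<Rightarrow> 'a" where
  "mat2_trace R A = (\<Oplus>\<^bsub>R\<^esub>i\<in>UNIV. A $ i $ i)"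

definition GL2 :: "('a, 'm) ring_scheme \<Rightarrow> ('a^2^2) set" where
  "GL2 R = Units (mat2 R)"

definition sl2 :: "('a, 'm) ring_scheme \<Rightarrow> ('a^2^2) set" where
  "sl2 R = {X \<in> carrier (mat2 R). mat2_trace R X = \<zero>\<^bsub>R\<^esub>}"

text \<open>
  The family \<open>(v, w)\<close> is an \<open>R\<close>-basis of \<open>M\<close>: linearly independent and generating. This is a
  property of the ordered pair rather than of the set \<open>{v, w}\<close>, so \<open>v = w\<close> is not silently
  collapsed.
\<close>

definition basis_pair ::
    "('a, 'm) ring_scheme \<Rightarrow> ('a, 'b, 'n) module_scheme \<Rightarrow> 'b \<Rightarrow> 'b \<Rightarrow> bool" where
  "basis_pair R M v w \<longleftrightarrow>
     v \<in> carrier M \<and> w \<in> carrier M \<and>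
     (\<forall>a\<in>carrier R. \<forall>b\<in>carrier R.
        a \<odot>\<^bsub>M\<^esub> v \<oplus>\<^bsub>M\<^esub> b \<odot>\<^bsub>M\<^esub> w = \<zero>\<^bsub>M\<^esub> \<longrightarrow> a = \<zero>\<^bsub>R\<^esub> \<and> b = \<zero>\<^bsub>R\<^esub>) \<and>
     (\<forall>u\<in>carrier M. \<exists>a\<in>carrier R. \<exists>b\<in>carrier R. u = a \<odot>\<^bsub>M\<^esub> v \<oplus>\<^bsub>M\<^esub> b \<odot>\<^bsub>M\<^esub> w)"

definition cyclic_mat2 :: "('a, 'm) ring_scheme \<Rightarrow> 'a^2^2 \<Rightarrow> bool" where
  "cyclic_mat2 R C \<longleftrightarrow>
     (\<exists>v\<in>carrier (vec2 R). basis_pair R (vec2 R) v (mat2_mult_vec R C v))"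

definition similarity_orbit :: "('a, 'm) ring_scheme \<Rightarrow> 'a^2^2 \<Rightarrow> ('a^2^2) set" where
  "similarity_orbit R C =
     {P \<otimes>\<^bsub>mat2 R\<^esub> C \<otimes>\<^bsub>mat2 R\<^esub> inv\<^bsub>mat2 R\<^esub> P | P. P \<in> GL2 R}"

text \<open>
  \<open>LinearCombinations.module.span\<close> is the set of finite \<open>R\<close>-linear combinations in a HOL-Algebra
  module; the qualifier distinguishes it from the type-class based \<open>Modules.module.span\<close>.
\<close>

definition orbit_difference_module :: "('a, 'm) ring_scheme \<Rightarrow> 'a^2^2 \<Rightarrow> ('a^2^2) set" where
  "orbit_difference_module R C =
     LinearCombinations.module.span R (mat2 R)
       {K \<ominus>\<^bsub>mat2 R\<^esub> K' | K K'. K \<in> similarity_orbit R C \<and> K' \<in> similarity_orbit R C}"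

end

theory Submission
  imports Defs "HOL-Analysis.Cartesian_Space"
begin

text \<open>
  Differences of similar matrices are traceless because \<open>tr (P C P\<^sup>-\<^sup>1) = tr C\<close>, so only
  \<open>sl\<^sub>2(R) \<subseteq> D\<^sub>C\<close> has content. If \<open>(v, C v)\<close> is a basis, then in this basis \<open>C\<close> becomes a matrix
  \<open>B = (0, e; 1, t)\<close> (\<open>cyclic_orbit_contains_companion\<close>). Since \<open>B\<close> lies in the orbit of \<open>C\<close>, so
  do all conjugates of \<open>B\<close>. Three of them suffice:

  \<^item> conjugating by \<open>(1, 1; 0, 1)\<close> gives \<open>K\<close> with \<open>K - B = (1, t - 1; 0, -1)\<close>;
  \<^item> conjugating by \<open>(1, -1; 0, 1)\<close> gives \<open>L\<close> with \<open>B - L = (1, t + 1; 0, -1)\<close>;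
  \<^item> conjugating by \<open>(1, 0; 0, -1)\<close> gives \<open>N\<close> with \<open>B - N = (0, 2 e; 2, 0)\<close>.

  The second difference minus the first is \<open>(0, 2; 0, 0)\<close>. So, as \<open>2\<close> is a unit, these three
  differences span all of \<open>sl\<^sub>2(R)\<close>; the coefficients that produce a given traceless matrix are
  written out in the proof of the theorem.
\<close>

section \<open>Matrix arithmetic over a carrier ring\<close>

definition matrix2 :: "'a \<Rightarrow> 'a \<Rightarrow> 'a \<Rightarrow> 'a \<Rightarrow> 'a^2^2" where
  "matrix2 a b c d = (\<chi> i j. if i = 1 then if j = 1 then a else b else if j = 1 then c else d)"

lemma matrix2_nth [simp]:
  "matrix2 a b c d $ 1 $ 1 = a" "matrix2 a b c d $ 1 $ 2 = b"
  "matrix2 a b c d $ 2 $ 1 = c" "matrix2 a b c d $ 2 $ 2 = d"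
  by (simp_all add: matrix2_def)

lemma matrix2_eq_iff:
  "A = B \<longleftrightarrow> A $ 1 $ 1 = B $ 1 $ 1 \<and> A $ 1 $ 2 = B $ 1 $ 2 \<and>
     A $ 2 $ 1 = B $ 2 $ 1 \<and> A $ 2 $ 2 = B $ 2 $ 2" for A B :: "'a^2^2"
  by (simp add: vec_eq_iff forall_2)

lemma vector2_eq_iff: "v = w \<longleftrightarrow> v $ 1 = w $ 1 \<and> v $ 2 = w $ 2" for v w :: "'a^2"
  by (simp add: vec_eq_iff forall_2)

lemma mat2_carrier_iff:
  "A \<in> carrier (mat2 R) \<longleftrightarrow> A $ 1 $ 1 \<in> carrier R \<and> A $ 1 $ 2 \<in> carrier R \<and>
     A $ 2 $ 1 \<in> carrier R \<and> A $ 2 $ 2 \<in> carrier R"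
  by (auto simp: mat2_def forall_2)

lemma mat2_nth_closed: "A \<in> carrier (mat2 R) \<Longrightarrow> A $ i $ j \<in> carrier R"
  by (simp add: mat2_def)

lemma mat2_add_nth [simp]: "(A \<oplus>\<^bsub>mat2 R\<^esub> B) $ i $ j = A $ i $ j \<oplus>\<^bsub>R\<^esub> B $ i $ j"
  by (simp add: mat2_def)

lemma mat2_smult_nth [simp]: "(a \<odot>\<^bsub>mat2 R\<^esub> A) $ i $ j = a \<otimes>\<^bsub>R\<^esub> A $ i $ j"
  by (simp add: mat2_def)

lemma mat2_zero_nth [simp]: "\<zero>\<^bsub>mat2 R\<^esub> $ i $ j = \<zero>\<^bsub>R\<^esub>"
  by (simp add: mat2_def)

lemma mat2_one_nth [simp]: "\<one>\<^bsub>mat2 R\<^esub> $ i $ j = (if i = j then \<one>\<^bsub>R\<^esub> else \<zero>\<^bsub>R\<^esub>)"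
  by (simp add: mat2_def)

lemma vec2_carrier_iff: "v \<in> carrier (vec2 R) \<longleftrightarrow> v $ 1 \<in> carrier R \<and> v $ 2 \<in> carrier R"
  by (auto simp: vec2_def forall_2)

lemma vec2_nth [simp]:
  "(v \<oplus>\<^bsub>vec2 R\<^esub> w) $ i = v $ i \<oplus>\<^bsub>R\<^esub> w $ i"
  "(a \<odot>\<^bsub>vec2 R\<^esub> v) $ i = a \<otimes>\<^bsub>R\<^esub> v $ i"
  "\<zero>\<^bsub>vec2 R\<^esub> $ i = \<zero>\<^bsub>R\<^esub>"
  by (simp_all add: vec2_def)

context cring
begin

lemma finsum_2:
  fixes f :: "2 \<Rightarrow> 'a"
  assumes "f 1 \<in> carrier R" "f 2 \<in> carrier R"
  shows "finsum R f UNIV = f 1 \<oplus> f 2"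
  using assms by (simp add: UNIV_2)

lemma mat2_mult_nth:
  assumes "A \<in> carrier (mat2 R)" "B \<in> carrier (mat2 R)"
  shows "(A \<otimes>\<^bsub>mat2 R\<^esub> B) $ i $ j = A $ i $ 1 \<otimes> B $ 1 $ j \<oplus> A $ i $ 2 \<otimes> B $ 2 $ j"
  using assms by (simp add: mat2_def finsum_2)

lemma mat2_mult_vec_nth:
  assumes "A \<in> carrier (mat2 R)" "v \<in> carrier (vec2 R)"
  shows "mat2_mult_vec R A v $ i = A $ i $ 1 \<otimes> v $ 1 \<oplus> A $ i $ 2 \<otimes> v $ 2"
  using assms by (simp add: mat2_mult_vec_def mat2_nth_closed vec2_carrier_iff finsum_2)

lemma mat2_trace_eq:
  assumes "A \<in> carrier (mat2 R)"
  shows "mat2_trace R A = A $ 1 $ 1 \<oplus> A $ 2 $ 2"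
  using assms by (simp add: mat2_trace_def mat2_nth_closed finsum_2)

lemma mat2_mult_closed:
  assumes "A \<in> carrier (mat2 R)" "B \<in> carrier (mat2 R)"
  shows "A \<otimes>\<^bsub>mat2 R\<^esub> B \<in> carrier (mat2 R)"
  using assms by (simp add: mat2_carrier_iff[of "A \<otimes>\<^bsub>mat2 R\<^esub> B"] mat2_mult_nth mat2_nth_closed)

lemma monoid_mat2: "monoid (mat2 R)"
proof (rule monoidI)
  fix A B C
  assume A: "A \<in> carrier (mat2 R)" and B: "B \<in> carrier (mat2 R)" and C: "C \<in> carrier (mat2 R)"
  note entries = mat2_nth_closed[OF A] mat2_nth_closed[OF B] mat2_nth_closed[OF C]
  show "A \<otimes>\<^bsub>mat2 R\<^esub> B \<otimes>\<^bsub>mat2 R\<^esub> C = A \<otimes>\<^bsub>mat2 R\<^esub> (B \<otimes>\<^bsub>mat2 R\<^esub> C)"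
    using entries
    by (simp add: matrix2_eq_iff mat2_mult_nth mat2_mult_closed A B C l_distr r_distr m_assoc a_ac)
qed (auto simp: matrix2_eq_iff mat2_mult_nth mat2_mult_closed mat2_carrier_iff)

lemma module_mat2: "module R (mat2 R)"
proof (rule moduleI)
  show "cring R" by (rule is_cring)
  show "abelian_group (mat2 R)"
  proof (rule abelian_groupI)
    fix A assume A: "A \<in> carrier (mat2 R)"
    then show "\<exists>B\<in>carrier (mat2 R). B \<oplus>\<^bsub>mat2 R\<^esub> A = \<zero>\<^bsub>mat2 R\<^esub>"
      by (intro bexI[of _ "matrix2 (\<ominus> A $ 1 $ 1) (\<ominus> A $ 1 $ 2) (\<ominus> A $ 2 $ 1) (\<ominus> A $ 2 $ 2)"])
        (auto simp: matrix2_eq_iff mat2_carrier_iff l_neg)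
  qed (auto simp: matrix2_eq_iff mat2_carrier_iff a_ac)
qed (auto simp: matrix2_eq_iff mat2_carrier_iff l_distr r_distr m_assoc)

lemma mat2_minus_nth:
  assumes A: "A \<in> carrier (mat2 R)" and B: "B \<in> carrier (mat2 R)"
  shows "(A \<ominus>\<^bsub>mat2 R\<^esub> B) $ i $ j = A $ i $ j \<ominus> B $ i $ j"
proof -
  interpret M: module R "mat2 R" by (rule module_mat2)
  have "B $ i $ j \<oplus> (\<ominus>\<^bsub>mat2 R\<^esub> B) $ i $ j = \<zero>"
    using M.r_neg[OF B] by (metis mat2_add_nth mat2_zero_nth)
  then have "(\<ominus>\<^bsub>mat2 R\<^esub> B) $ i $ j = \<ominus> B $ i $ j"
    using B by (metis M.a_inv_closed minus_equality mat2_nth_closed a_comm)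
  then show ?thesis by (simp add: a_minus_def)
qed

lemma mat2_trace_mult_commute:
  assumes "A \<in> carrier (mat2 R)" "B \<in> carrier (mat2 R)"
  shows "mat2_trace R (A \<otimes>\<^bsub>mat2 R\<^esub> B) = mat2_trace R (B \<otimes>\<^bsub>mat2 R\<^esub> A)"
  using assms
  by (simp add: mat2_trace_eq mat2_mult_closed mat2_mult_nth mat2_nth_closed m_comm a_ac)

section \<open>Similarity orbits\<close>

lemma similarity_orbitI:
  assumes "P \<in> carrier (mat2 R)" "Q \<in> carrier (mat2 R)"
    and "P \<otimes>\<^bsub>mat2 R\<^esub> Q = \<one>\<^bsub>mat2 R\<^esub>" "Q \<otimes>\<^bsub>mat2 R\<^esub> P = \<one>\<^bsub>mat2 R\<^esub>"
  shows "P \<otimes>\<^bsub>mat2 R\<^esub> C \<otimes>\<^bsub>mat2 R\<^esub> Q \<in> similarity_orbit R C"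
proof -
  interpret monoid "mat2 R" by (rule monoid_mat2)
  have "Q = inv\<^bsub>mat2 R\<^esub> P" "P \<in> Units (mat2 R)"
    using assms inv_unique' by (auto simp: Units_def)
  then show ?thesis by (auto simp: similarity_orbit_def GL2_def)
qed

lemma similarity_orbit_trans:
  assumes C: "C \<in> carrier (mat2 R)" and B: "B \<in> similarity_orbit R C"
    and K: "K \<in> similarity_orbit R B"
  shows "K \<in> similarity_orbit R C"
proof -
  interpret M: monoid "mat2 R" by (rule monoid_mat2)
  obtain P where P: "P \<in> Units (mat2 R)" "B = P \<otimes>\<^bsub>mat2 R\<^esub> C \<otimes>\<^bsub>mat2 R\<^esub> inv\<^bsub>mat2 R\<^esub> P"
    using B by (auto simp: similarity_orbit_def GL2_def)
  obtain Q where Q: "Q \<in> Units (mat2 R)" "K = Q \<otimes>\<^bsub>mat2 R\<^esub> B \<otimes>\<^bsub>mat2 R\<^esub> inv\<^bsub>mat2 R\<^esub> Q"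
    using K by (auto simp: similarity_orbit_def GL2_def)
  define P' Q' where "P' = inv\<^bsub>mat2 R\<^esub> P" and "Q' = inv\<^bsub>mat2 R\<^esub> Q"
  have cl: "P \<in> carrier (mat2 R)" "P' \<in> carrier (mat2 R)" "Q \<in> carrier (mat2 R)" "Q' \<in> carrier (mat2 R)"
    using P(1) Q(1) by (simp_all add: P'_def Q'_def M.Units_closed)
  have "P \<otimes>\<^bsub>mat2 R\<^esub> (P' \<otimes>\<^bsub>mat2 R\<^esub> Q') = Q'"
    using cl P(1) by (simp add: P'_def flip: M.m_assoc)
  then have right: "Q \<otimes>\<^bsub>mat2 R\<^esub> P \<otimes>\<^bsub>mat2 R\<^esub> (P' \<otimes>\<^bsub>mat2 R\<^esub> Q') = \<one>\<^bsub>mat2 R\<^esub>"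
    using cl Q(1) by (simp add: M.m_assoc) (simp add: Q'_def)
  have "Q' \<otimes>\<^bsub>mat2 R\<^esub> (Q \<otimes>\<^bsub>mat2 R\<^esub> P) = P"
    using cl Q(1) by (simp add: Q'_def flip: M.m_assoc)
  then have left: "P' \<otimes>\<^bsub>mat2 R\<^esub> Q' \<otimes>\<^bsub>mat2 R\<^esub> (Q \<otimes>\<^bsub>mat2 R\<^esub> P) = \<one>\<^bsub>mat2 R\<^esub>"
    using cl P(1) by (simp add: M.m_assoc) (simp add: P'_def)
  have "(Q \<otimes>\<^bsub>mat2 R\<^esub> P) \<otimes>\<^bsub>mat2 R\<^esub> C \<otimes>\<^bsub>mat2 R\<^esub> (P' \<otimes>\<^bsub>mat2 R\<^esub> Q') \<in> similarity_orbit R C"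
    using cl right left by (intro similarity_orbitI M.m_closed)
  moreover have "K = (Q \<otimes>\<^bsub>mat2 R\<^esub> P) \<otimes>\<^bsub>mat2 R\<^esub> C \<otimes>\<^bsub>mat2 R\<^esub> (P' \<otimes>\<^bsub>mat2 R\<^esub> Q')"
    unfolding P(2) Q(2) P'_def[symmetric] Q'_def[symmetric] using cl C by (simp add: M.m_assoc)
  ultimately show ?thesis by simp
qed

lemma similarity_orbit_carrier_trace:
  assumes C: "C \<in> carrier (mat2 R)" and K: "K \<in> similarity_orbit R C"
  shows "K \<in> carrier (mat2 R)" "mat2_trace R K = mat2_trace R C"
proof -
  interpret M: monoid "mat2 R" by (rule monoid_mat2)
  obtain P where P: "P \<in> Units (mat2 R)" and K_eq: "K = P \<otimes>\<^bsub>mat2 R\<^esub> C \<otimes>\<^bsub>mat2 R\<^esub> inv\<^bsub>mat2 R\<^esub> P"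
    using K by (auto simp: similarity_orbit_def GL2_def)
  show "K \<in> carrier (mat2 R)" using P C K_eq by (simp add: M.Units_closed)
  have "mat2_trace R K = mat2_trace R (inv\<^bsub>mat2 R\<^esub> P \<otimes>\<^bsub>mat2 R\<^esub> (P \<otimes>\<^bsub>mat2 R\<^esub> C))"
    unfolding K_eq using P C by (intro mat2_trace_mult_commute) (auto simp: M.Units_closed)
  also have "\<dots> = mat2_trace R C"
    using P C by (simp add: M.Units_closed flip: M.m_assoc)
  finally show "mat2_trace R K = mat2_trace R C" .
qed

section \<open>The companion form of a cyclic matrix\<close>

text \<open>
  Spanning gives a right inverse column by column. It is also a left inverse because independence
  makes left multiplication by \<open>P\<close> injective, so \<open>P (Q P) = P\<close> can be cancelled.
\<close>

lemma basis_columns_invertible: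
  assumes basis: "basis_pair R (vec2 R) v w"
  defines "P \<equiv> matrix2 (v $ 1) (w $ 1) (v $ 2) (w $ 2)"
  shows "\<exists>Q\<in>carrier (mat2 R). P \<otimes>\<^bsub>mat2 R\<^esub> Q = \<one>\<^bsub>mat2 R\<^esub> \<and> Q \<otimes>\<^bsub>mat2 R\<^esub> P = \<one>\<^bsub>mat2 R\<^esub>"
proof -
  interpret M: monoid "mat2 R" by (rule monoid_mat2)
  have vw: "v $ 1 \<in> carrier R" "v $ 2 \<in> carrier R" "w $ 1 \<in> carrier R" "w $ 2 \<in> carrier R"
    using basis by (auto simp: basis_pair_def vec2_carrier_iff)
  have indep: "a = \<zero> \<and> b = \<zero>"
    if "a \<in> carrier R" "b \<in> carrier R"
      "a \<otimes> v $ 1 \<oplus> b \<otimes> w $ 1 = \<zero>" "a \<otimes> v $ 2 \<oplus> b \<otimes> w $ 2 = \<zero>" for a b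
    using basis that by (auto simp: basis_pair_def vector2_eq_iff)
  have span: "\<exists>a\<in>carrier R. \<exists>b\<in>carrier R.
      x = v $ 1 \<otimes> a \<oplus> w $ 1 \<otimes> b \<and> y = v $ 2 \<otimes> a \<oplus> w $ 2 \<otimes> b"
    if "x \<in> carrier R" "y \<in> carrier R" for x y
  proof -
    define u :: "'a^2" where "u = (\<chi> i. if i = 1 then x else y)"
    have u: "u $ 1 = x" "u $ 2 = y" by (simp_all add: u_def)
    then have "u \<in> carrier (vec2 R)" using that by (simp add: vec2_carrier_iff)
    then obtain a b where "a \<in> carrier R" "b \<in> carrier R"
      "u = a \<odot>\<^bsub>vec2 R\<^esub> v \<oplus>\<^bsub>vec2 R\<^esub> b \<odot>\<^bsub>vec2 R\<^esub> w"
      using basis by (auto simp: basis_pair_def)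
    then show ?thesis
      using vw u by (intro bexI[of _ a] bexI[of _ b]) (auto simp: vector2_eq_iff m_comm)
  qed
  have P: "P \<in> carrier (mat2 R)"
    using vw by (simp add: P_def mat2_carrier_iff)
  obtain a b where ab: "a \<in> carrier R" "b \<in> carrier R"
    "\<one> = v $ 1 \<otimes> a \<oplus> w $ 1 \<otimes> b" "\<zero> = v $ 2 \<otimes> a \<oplus> w $ 2 \<otimes> b"
    using span[of \<one> \<zero>] by auto
  obtain c d where cd: "c \<in> carrier R" "d \<in> carrier R"
    "\<zero> = v $ 1 \<otimes> c \<oplus> w $ 1 \<otimes> d" "\<one> = v $ 2 \<otimes> c \<oplus> w $ 2 \<otimes> d"
    using span[of \<zero> \<one>] by auto
  define Q where "Q = matrix2 a c b d"
  have Q: "Q \<in> carrier (mat2 R)"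
    using ab cd by (simp add: Q_def mat2_carrier_iff)
  have PQ: "P \<otimes>\<^bsub>mat2 R\<^esub> Q = \<one>\<^bsub>mat2 R\<^esub>"
    using ab cd by (simp add: matrix2_eq_iff mat2_mult_nth P Q) (simp add: P_def Q_def)
  have cancel: "Y = Z"
    if Y: "Y \<in> carrier (mat2 R)" and Z: "Z \<in> carrier (mat2 R)"
      and eq: "P \<otimes>\<^bsub>mat2 R\<^esub> Y = P \<otimes>\<^bsub>mat2 R\<^esub> Z" for Y Z
  proof -
    have "Y $ 1 $ j = Z $ 1 $ j \<and> Y $ 2 $ j = Z $ 2 $ j" for j
    proof -
      note cl = mat2_nth_closed[OF Y] mat2_nth_closed[OF Z] vw
      have row: "(Y $ 1 $ j \<ominus> Z $ 1 $ j) \<otimes> x \<oplus> (Y $ 2 $ j \<ominus> Z $ 2 $ j) \<otimes> y = \<zero>"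
        if "x \<otimes> Y $ 1 $ j \<oplus> y \<otimes> Y $ 2 $ j = x \<otimes> Z $ 1 $ j \<oplus> y \<otimes> Z $ 2 $ j"
          "x \<in> carrier R" "y \<in> carrier R" for x y
      proof -
        have "(Y $ 1 $ j \<ominus> Z $ 1 $ j) \<otimes> x \<oplus> (Y $ 2 $ j \<ominus> Z $ 2 $ j) \<otimes> y
          = (x \<otimes> Y $ 1 $ j \<oplus> y \<otimes> Y $ 2 $ j) \<ominus> (x \<otimes> Z $ 1 $ j \<oplus> y \<otimes> Z $ 2 $ j)"
          using cl that(2,3) by algebra
        then show ?thesis using that cl by (simp add: a_minus_def r_neg)
      qed
      have "(P \<otimes>\<^bsub>mat2 R\<^esub> Y) $ i $ j = (P \<otimes>\<^bsub>mat2 R\<^esub> Z) $ i $ j" for i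
        using eq by simp
      from this[of 1] this[of 2]
      have "Y $ 1 $ j \<ominus> Z $ 1 $ j = \<zero> \<and> Y $ 2 $ j \<ominus> Z $ 2 $ j = \<zero>"
        using cl by (intro indep row) (auto simp: mat2_mult_nth P Y Z, auto simp: P_def)
      then show ?thesis using cl by simp
    qed
    then show ?thesis by (simp add: matrix2_eq_iff)
  qed
  have "P \<otimes>\<^bsub>mat2 R\<^esub> (Q \<otimes>\<^bsub>mat2 R\<^esub> P) = P \<otimes>\<^bsub>mat2 R\<^esub> \<one>\<^bsub>mat2 R\<^esub>"
    using P Q PQ by (simp flip: M.m_assoc)
  with P Q have "Q \<otimes>\<^bsub>mat2 R\<^esub> P = \<one>\<^bsub>mat2 R\<^esub>"
    using cancel[of "Q \<otimes>\<^bsub>mat2 R\<^esub> P" "\<one>\<^bsub>mat2 R\<^esub>"] by simp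
  with PQ Q show ?thesis by blast
qed

text \<open>
  With \<open>P = (v, C v)\<close> the first column of \<open>C P\<close> is the second column of \<open>P\<close>, so the first column
  of \<open>P\<^sup>-\<^sup>1 C P\<close> is the second standard basis vector.
\<close>

lemma cyclic_orbit_contains_companion:
  assumes C: "C \<in> carrier (mat2 R)" and cyclic: "cyclic_mat2 R C"
  shows "\<exists>e\<in>carrier R. \<exists>t\<in>carrier R. matrix2 \<zero> e \<one> t \<in> similarity_orbit R C"
proof -
  interpret M: monoid "mat2 R" by (rule monoid_mat2)
  obtain v where v: "v \<in> carrier (vec2 R)"
    and basis: "basis_pair R (vec2 R) v (mat2_mult_vec R C v)"
    using cyclic by (auto simp: cyclic_mat2_def)
  define w where "w = mat2_mult_vec R C v"
  define P where "P = matrix2 (v $ 1) (w $ 1) (v $ 2) (w $ 2)"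
  have P: "P \<in> carrier (mat2 R)"
    using basis by (simp add: P_def w_def mat2_carrier_iff basis_pair_def vec2_carrier_iff)
  obtain Q where Q: "Q \<in> carrier (mat2 R)"
    and PQ: "P \<otimes>\<^bsub>mat2 R\<^esub> Q = \<one>\<^bsub>mat2 R\<^esub>" and QP: "Q \<otimes>\<^bsub>mat2 R\<^esub> P = \<one>\<^bsub>mat2 R\<^esub>"
    using basis_columns_invertible[OF basis] by (auto simp: P_def w_def)
  define B where "B = Q \<otimes>\<^bsub>mat2 R\<^esub> C \<otimes>\<^bsub>mat2 R\<^esub> P"
  have B: "B \<in> carrier (mat2 R)" using P Q C by (simp add: B_def)
  have CP: "(C \<otimes>\<^bsub>mat2 R\<^esub> P) $ 1 $ 1 = P $ 1 $ 2" "(C \<otimes>\<^bsub>mat2 R\<^esub> P) $ 2 $ 1 = P $ 2 $ 2"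
    using C v by (simp_all add: mat2_mult_nth P) (simp_all add: P_def w_def mat2_mult_vec_nth)
  have "B $ i $ 1 = (Q \<otimes>\<^bsub>mat2 R\<^esub> (C \<otimes>\<^bsub>mat2 R\<^esub> P)) $ i $ 1" for i
    using P Q C by (simp add: B_def M.m_assoc)
  also have "\<dots> i = (Q \<otimes>\<^bsub>mat2 R\<^esub> P) $ i $ 2" for i
    using P Q C CP by (simp add: mat2_mult_nth[of Q])
  finally have "B $ i $ 1 = \<one>\<^bsub>mat2 R\<^esub> $ i $ 2" for i
    by (simp add: QP)
  then have "B = matrix2 \<zero> (B $ 1 $ 2) \<one> (B $ 2 $ 2)"
    by (simp add: matrix2_eq_iff)
  moreover have "B \<in> similarity_orbit R C"
    unfolding B_def using Q P QP PQ by (rule similarity_orbitI)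
  ultimately show ?thesis
    using B by (metis mat2_nth_closed)
qed

lemma companion_conjugate_unipotent:
  assumes "e \<in> carrier R" "t \<in> carrier R" "x \<in> carrier R"
  shows "matrix2 x (e \<oplus> x \<otimes> t \<ominus> x \<otimes> x) \<one> (t \<ominus> x) \<in> similarity_orbit R (matrix2 \<zero> e \<one> t)"
proof -
  define P where "P = matrix2 \<one> x \<zero> \<one>"
  define Q where "Q = matrix2 \<one> (\<ominus> x) \<zero> \<one>"
  define B where "B = matrix2 \<zero> e \<one> t"
  have cl: "P \<in> carrier (mat2 R)" "Q \<in> carrier (mat2 R)" "B \<in> carrier (mat2 R)"
    using assms by (simp_all add: P_def Q_def B_def mat2_carrier_iff)
  have "P \<otimes>\<^bsub>mat2 R\<^esub> Q = \<one>\<^bsub>mat2 R\<^esub>" "Q \<otimes>\<^bsub>mat2 R\<^esub> P = \<one>\<^bsub>mat2 R\<^esub>"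
    using assms
    by (simp_all add: matrix2_eq_iff mat2_mult_nth cl) (simp_all add: P_def Q_def l_neg r_neg)
  then have "P \<otimes>\<^bsub>mat2 R\<^esub> B \<otimes>\<^bsub>mat2 R\<^esub> Q \<in> similarity_orbit R B"
    using cl by (intro similarity_orbitI)
  moreover have "P \<otimes>\<^bsub>mat2 R\<^esub> B \<otimes>\<^bsub>mat2 R\<^esub> Q = matrix2 x (e \<oplus> x \<otimes> t \<ominus> x \<otimes> x) \<one> (t \<ominus> x)"
    using assms
    by (simp add: matrix2_eq_iff mat2_mult_nth mat2_mult_closed cl)
      (simp add: P_def Q_def B_def a_minus_def r_minus a_ac)
  ultimately show ?thesis by (simp add: B_def)
qed

lemma companion_conjugate_diagonal:
  assumes "e \<in> carrier R" "t \<in> carrier R"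
  shows "matrix2 \<zero> (\<ominus> e) (\<ominus> \<one>) t \<in> similarity_orbit R (matrix2 \<zero> e \<one> t)"
proof -
  define P where "P = matrix2 \<one> \<zero> \<zero> (\<ominus> \<one>)"
  define B where "B = matrix2 \<zero> e \<one> t"
  have cl: "P \<in> carrier (mat2 R)" "B \<in> carrier (mat2 R)"
    using assms by (simp_all add: P_def B_def mat2_carrier_iff)
  have "P \<otimes>\<^bsub>mat2 R\<^esub> P = \<one>\<^bsub>mat2 R\<^esub>"
    by (simp add: matrix2_eq_iff mat2_mult_nth cl) (simp add: P_def l_minus r_minus)
  then have "P \<otimes>\<^bsub>mat2 R\<^esub> B \<otimes>\<^bsub>mat2 R\<^esub> P \<in> similarity_orbit R B"
    using cl by (intro similarity_orbitI)
  moreover have "P \<otimes>\<^bsub>mat2 R\<^esub> B \<otimes>\<^bsub>mat2 R\<^esub> P = matrix2 \<zero> (\<ominus> e) (\<ominus> \<one>) t"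
    using assms
    by (simp add: matrix2_eq_iff mat2_mult_nth mat2_mult_closed cl)
      (simp add: P_def B_def l_minus r_minus)
  ultimately show ?thesis by (simp add: B_def)
qed

section \<open>The orbit-difference module\<close>

lemma submodule_sl2: "LinearCombinations.submodule R (sl2 R) (mat2 R)"
proof -
  interpret M: module R "mat2 R" by (rule module_mat2)
  show ?thesis
  proof (rule LinearCombinations.submodule.intro)
    show "module R (mat2 R)" by (rule module_mat2)
    show "sl2 R \<subseteq> carrier (mat2 R)" by (auto simp: sl2_def)
    show "\<zero>\<^bsub>mat2 R\<^esub> \<in> sl2 R" by (simp add: sl2_def mat2_trace_eq)
  next
    fix A B assume A: "A \<in> sl2 R" and B: "B \<in> sl2 R"
    then have cl: "A \<in> carrier (mat2 R)" "B \<in> carrier (mat2 R)"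
      and tr: "A $ 1 $ 1 \<oplus> A $ 2 $ 2 = \<zero>" "B $ 1 $ 1 \<oplus> B $ 2 $ 2 = \<zero>"
      by (auto simp: sl2_def mat2_trace_eq)
    have "A $ 1 $ 1 \<oplus> B $ 1 $ 1 \<oplus> (A $ 2 $ 2 \<oplus> B $ 2 $ 2)
        = (A $ 1 $ 1 \<oplus> A $ 2 $ 2) \<oplus> (B $ 1 $ 1 \<oplus> B $ 2 $ 2)"
      using cl[THEN mat2_nth_closed] by (simp add: a_ac)
    then show "A \<oplus>\<^bsub>mat2 R\<^esub> B \<in> sl2 R"
      using cl tr by (simp add: sl2_def mat2_trace_eq)
  next
    fix a A assume a: "a \<in> carrier R" and A: "A \<in> sl2 R"
    then have "A \<in> carrier (mat2 R)" "A $ 1 $ 1 \<oplus> A $ 2 $ 2 = \<zero>"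
      by (auto simp: sl2_def mat2_trace_eq)
    with a show "a \<odot>\<^bsub>mat2 R\<^esub> A \<in> sl2 R"
      by (simp add: sl2_def mat2_trace_eq mat2_nth_closed flip: r_distr)
  qed
qed

lemma similarity_orbit_difference_in_sl2:
  assumes C: "C \<in> carrier (mat2 R)"
    and "K \<in> similarity_orbit R C" "L \<in> similarity_orbit R C"
  shows "K \<ominus>\<^bsub>mat2 R\<^esub> L \<in> sl2 R"
proof -
  interpret M: module R "mat2 R" by (rule module_mat2)
  have cl: "K \<in> carrier (mat2 R)" "L \<in> carrier (mat2 R)"
    and tr: "mat2_trace R K = mat2_trace R L"
    using assms by (auto simp: similarity_orbit_carrier_trace)
  have "mat2_trace R (K \<ominus>\<^bsub>mat2 R\<^esub> L)
      = (K $ 1 $ 1 \<ominus> L $ 1 $ 1) \<oplus> (K $ 2 $ 2 \<ominus> L $ 2 $ 2)"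
    using cl by (simp add: mat2_trace_eq mat2_minus_nth)
  also have "\<dots> = mat2_trace R K \<ominus> mat2_trace R L"
    using cl[THEN mat2_nth_closed] cl
    by (simp add: mat2_trace_eq a_minus_def minus_add a_ac)
  also have "\<dots> = \<zero>"
    using cl[THEN mat2_nth_closed] cl tr by (simp add: mat2_trace_eq a_minus_def r_neg)
  finally show ?thesis using cl by (simp add: sl2_def)
qed

end

theorem theorem2p5:
  fixes R :: "('a, 'm) ring_scheme" (structure) and C :: "'a^2^2"
  assumes "cring R"
    and "\<one> \<oplus> \<one> \<in> Units R"
    and "C \<in> carrier (mat2 R)"
    and "cyclic_mat2 R C"
  shows "orbit_difference_module R C = sl2 R"
proof -
  interpret cring R by fact
  interpret M: module R "mat2 R" by (rule module_mat2)
  note two = \<open>\<one> \<oplus> \<one> \<in> Units R\<close> and C = \<open>C \<in> carrier (mat2 R)\<close>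
  define S where "S = {K \<ominus>\<^bsub>mat2 R\<^esub> L | K L. K \<in> similarity_orbit R C \<and> L \<in> similarity_orbit R C}"
  have D_eq: "orbit_difference_module R C = M.span S"
    by (simp add: orbit_difference_module_def S_def)
  have S_sl2: "S \<subseteq> sl2 R"
    using C by (auto simp: S_def similarity_orbit_difference_in_sl2)
  then have S_carrier: "S \<subseteq> carrier (mat2 R)"
    by (auto simp: sl2_def)
  interpret D: LinearCombinations.submodule R "M.span S" "mat2 R"
    using S_carrier by (rule M.span_is_submodule)
  have "sl2 R \<subseteq> M.span S"
  proof
    fix X assume "X \<in> sl2 R"
    then have X: "X \<in> carrier (mat2 R)" and trX: "X $ 1 $ 1 \<oplus> X $ 2 $ 2 = \<zero>"
      by (auto simp: sl2_def mat2_trace_eq)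
    obtain e t where e: "e \<in> carrier R" and t: "t \<in> carrier R"
      and B_orbit: "matrix2 \<zero> e \<one> t \<in> similarity_orbit R C"
      using cyclic_orbit_contains_companion[OF C \<open>cyclic_mat2 R C\<close>] by auto
    define B where "B = matrix2 \<zero> e \<one> t"
    \<comment> \<open>The conjugates of \<open>B\<close> by \<open>(1, x; 0, 1)\<close> for \<open>x = 1\<close> and \<open>x = -1\<close>, left unsimplified
      so that they are literal instances of the general formula.\<close>
    define K where "K = matrix2 \<one> (e \<oplus> \<one> \<otimes> t \<ominus> \<one> \<otimes> \<one>) \<one> (t \<ominus> \<one>)"
    define L where "L = matrix2 (\<ominus> \<one>) (e \<oplus> \<ominus> \<one> \<otimes> t \<ominus> \<ominus> \<one> \<otimes> \<ominus> \<one>) \<one> (t \<ominus> \<ominus> \<one>)"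
    define N where "N = matrix2 \<zero> (\<ominus> e) (\<ominus> \<one>) t"
    have orbit: "B \<in> similarity_orbit R C" "K \<in> similarity_orbit R C"
      "L \<in> similarity_orbit R C" "N \<in> similarity_orbit R C"
      unfolding B_def K_def L_def N_def
      by (intro B_orbit similarity_orbit_trans[OF C B_orbit] companion_conjugate_unipotent
          companion_conjugate_diagonal e t a_inv_closed one_closed)+
    have cl: "B \<in> carrier (mat2 R)" "K \<in> carrier (mat2 R)" "L \<in> carrier (mat2 R)"
      "N \<in> carrier (mat2 R)"
      using orbit C similarity_orbit_carrier_trace(1) by blast+
    have diffs: "K \<ominus>\<^bsub>mat2 R\<^esub> B \<in> M.span S" "B \<ominus>\<^bsub>mat2 R\<^esub> L \<in> M.span S"
      "B \<ominus>\<^bsub>mat2 R\<^esub> N \<in> M.span S"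
      using M.in_own_span[OF S_carrier] orbit by (auto simp: S_def)
    have diff_eqs:
      "K \<ominus>\<^bsub>mat2 R\<^esub> B = matrix2 \<one> (t \<ominus> \<one>) \<zero> (\<ominus> \<one>)"
      "B \<ominus>\<^bsub>mat2 R\<^esub> L = matrix2 \<one> (t \<oplus> \<one>) \<zero> (\<ominus> \<one>)"
      "B \<ominus>\<^bsub>mat2 R\<^esub> N = matrix2 \<zero> (e \<oplus> e) (\<one> \<oplus> \<one>) \<zero>"
    proof -
      have entries:
        "e \<oplus> \<one> \<otimes> t \<ominus> \<one> \<otimes> \<one> \<ominus> e = t \<ominus> \<one>" "t \<ominus> \<one> \<ominus> t = \<ominus> \<one>"
        "\<zero> \<ominus> \<ominus> \<one> = \<one>" "e \<ominus> (e \<oplus> \<ominus> \<one> \<otimes> t \<ominus> \<ominus> \<one> \<otimes> \<ominus> \<one>) = t \<oplus> \<one>"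
        "t \<ominus> (t \<ominus> \<ominus> \<one>) = \<ominus> \<one>" "e \<ominus> \<ominus> e = e \<oplus> e" "\<one> \<ominus> \<ominus> \<one> = \<one> \<oplus> \<one>"
        "\<one> \<ominus> \<zero> = \<one>" "\<zero> \<ominus> \<zero> = \<zero>" "\<one> \<ominus> \<one> = \<zero>" "t \<ominus> t = \<zero>"
        using e t by algebra+
      show "K \<ominus>\<^bsub>mat2 R\<^esub> B = matrix2 \<one> (t \<ominus> \<one>) \<zero> (\<ominus> \<one>)"
        "B \<ominus>\<^bsub>mat2 R\<^esub> L = matrix2 \<one> (t \<oplus> \<one>) \<zero> (\<ominus> \<one>)"
        "B \<ominus>\<^bsub>mat2 R\<^esub> N = matrix2 \<zero> (e \<oplus> e) (\<one> \<oplus> \<one>) \<zero>"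
        unfolding matrix2_eq_iff mat2_minus_nth[OF cl(2,1)] mat2_minus_nth[OF cl(1,3)]
          mat2_minus_nth[OF cl(1,4)]
        unfolding B_def K_def L_def N_def matrix2_nth entries
        by (rule conjI refl)+
    qed
    define h where "h = inv (\<one> \<oplus> \<one>)"
    have h: "h \<in> carrier R"
      using two by (simp add: h_def)
    have "h \<oplus> h = h \<otimes> (\<one> \<oplus> \<one>)"
      using h by (simp add: r_distr)
    then have h_two: "h \<oplus> h = \<one>"
      using two by (simp add: h_def)
    have halves: "h \<otimes> x \<oplus> h \<otimes> x = x" if "x \<in> carrier R" for x
      using h h_two that by (simp flip: l_distr)
    define p q r where "p = X $ 1 $ 1" and "q = X $ 1 $ 2" and "r = X $ 2 $ 1"
    have pqr: "p \<in> carrier R" "q \<in> carrier R" "r \<in> carrier R"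
      using X by (simp_all add: p_def q_def r_def mat2_nth_closed)
    have X_eq: "X = matrix2 p q r (\<ominus> p)"
      using X trX by (simp add: matrix2_eq_iff p_def q_def r_def)
        (metis a_comm minus_equality mat2_nth_closed)
    \<comment> \<open>Writing \<open>X\<close> as \<open>\<alpha> (K - B) + \<beta> (B - L) + h r (B - N)\<close> forces \<open>\<alpha> + \<beta> = p\<close> on the
      diagonal and \<open>\<beta> - \<alpha> = z\<close> in the upper right corner.\<close>
    define z where "z = q \<ominus> r \<otimes> e \<ominus> p \<otimes> t"
    define \<alpha> where "\<alpha> = h \<otimes> (p \<ominus> z)"
    define \<beta> where "\<beta> = h \<otimes> (p \<oplus> z)"
    have z: "z \<in> carrier R" using pqr e t by (simp add: z_def)
    have coeffs: "\<alpha> \<in> carrier R" "\<beta> \<in> carrier R" "h \<otimes> r \<in> carrier R"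
      using h pqr z by (simp_all add: \<alpha>_def \<beta>_def)
    have "X = \<alpha> \<odot>\<^bsub>mat2 R\<^esub> (K \<ominus>\<^bsub>mat2 R\<^esub> B) \<oplus>\<^bsub>mat2 R\<^esub> \<beta> \<odot>\<^bsub>mat2 R\<^esub> (B \<ominus>\<^bsub>mat2 R\<^esub> L)
        \<oplus>\<^bsub>mat2 R\<^esub> (h \<otimes> r) \<odot>\<^bsub>mat2 R\<^esub> (B \<ominus>\<^bsub>mat2 R\<^esub> N)"
    proof -
      have sum: "\<alpha> \<oplus> \<beta> = p"
      proof -
        have "\<alpha> \<oplus> \<beta> = h \<otimes> p \<oplus> h \<otimes> p"
          using h pqr z unfolding \<alpha>_def \<beta>_def by algebra
        then show ?thesis using halves pqr by simp
      qed
      have diff: "\<beta> \<ominus> \<alpha> = z"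
      proof -
        have "\<beta> \<ominus> \<alpha> = h \<otimes> z \<oplus> h \<otimes> z"
          using h pqr z unfolding \<alpha>_def \<beta>_def by algebra
        then show ?thesis using halves z by simp
      qed
      have "\<alpha> \<otimes> (t \<ominus> \<one>) \<oplus> \<beta> \<otimes> (t \<oplus> \<one>) \<oplus> h \<otimes> r \<otimes> (e \<oplus> e)
          = (\<alpha> \<oplus> \<beta>) \<otimes> t \<oplus> (\<beta> \<ominus> \<alpha>) \<oplus> (h \<otimes> r \<oplus> h \<otimes> r) \<otimes> e"
        using coeffs(1,2) h pqr e t by algebra
      also have "\<dots> = p \<otimes> t \<oplus> z \<oplus> r \<otimes> e"
        using sum diff halves pqr by simp
      also have "\<dots> = q"
        using pqr e t unfolding z_def by algebra
      finally have upper: "\<alpha> \<otimes> (t \<ominus> \<one>) \<oplus> \<beta> \<otimes> (t \<oplus> \<one>) \<oplus> h \<otimes> r \<otimes> (e \<oplus> e) = q" .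
      have lower: "h \<otimes> r \<otimes> (\<one> \<oplus> \<one>) = r"
        using halves h pqr by (simp add: r_distr)
      have corner: "\<alpha> \<otimes> \<ominus> \<one> \<oplus> \<beta> \<otimes> \<ominus> \<one> = \<ominus> p"
        using coeffs(1,2) by (simp add: r_minus minus_add flip: sum)
      show ?thesis
        using sum upper lower corner coeffs pqr
        by (simp add: matrix2_eq_iff X_eq diff_eqs)
    qed
    also have "\<dots> \<in> M.span S"
      using diffs coeffs by (intro D.m_closed D.smult_closed)
    finally show "X \<in> M.span S" .
  qed
  moreover have "M.span S \<subseteq> sl2 R"
    using S_sl2 submodule_sl2 by (rule M.span_is_subset)
  ultimately show ?thesis
    by (simp add: D_eq)
qed

end
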